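(* Let $(K,<,v)$ be an ordered henselian valued field, i.e., $(K,<)$ is an ordered field and $v$ is a henselian valuation on $K$. Then any $\mathcal{L}_{\mathrm{or}}$-definable valuation $w$ on $K$ is comparable to $v$.
   Context: $\mathcal{L}_{\mathrm{or}}=\{+,-,\cdot,0,1,<\}$ is the language of ordered rings. "Definable" means first-order definable with parameters, and a valuation $w$ on $K$ is $\mathcal{L}_{\mathrm{or}}$-definable if its valuation ring $\mathcal{O}_w$ is an $\mathcal{L}_{\mathrm{or}}$-definable subset of $(K,<)$; $w$ is not assumed to be convex. Two valuations $v,w$ on $K$ are comparable if $\mathcal{O}_v\subseteq\mathcal{O}_w$ or $\mathcal{O}_w\subseteq\mathcal{O}_v$. *)

theory Defs
  imports "HOL-Library.Extended" "HOL-Computational_Algebra.Polynomial"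
begin

datatype or_term =
    Var nat
  | Zero
  | One
  | Add or_term or_term
  | Neg or_term
  | Mul or_term or_term

datatype or_formula =
    Eq or_term or_term
  | Less or_term or_term
  | Negation or_formula
  | Conj or_formula or_formula
  | Exists or_formula

text \<open>
  Variables are de Bruijn indices: \<open>Exists\<close> binds index \<open>0\<close> and shifts the other indices up by one.
\<close>

primrec or_eval ::
  "(nat \<Rightarrow> 'a::{zero,one,plus,uminus,times,ord}) \<Rightarrow> or_term \<Rightarrow> 'a" where
  "or_eval e (Var i) = e i"
| "or_eval e Zero = 0"
| "or_eval e One = 1"
| "or_eval e (Add s t) = or_eval e s + or_eval e t"
| "or_eval e (Neg s) = - or_eval e s"
| "or_eval e (Mul s t) = or_eval e s * or_eval e t"

primrec or_sat ::
  "(nat \<Rightarrow> 'a::{zero,one,plus,uminus,times,ord}) \<Rightarrow> or_formula \<Rightarrow> bool" where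
  "or_sat e (Eq s t) \<longleftrightarrow> or_eval e s = or_eval e t"
| "or_sat e (Less s t) \<longleftrightarrow> or_eval e s < or_eval e t"
| "or_sat e (Negation p) \<longleftrightarrow> \<not> or_sat e p"
| "or_sat e (Conj p q) \<longleftrightarrow> or_sat e p \<and> or_sat e q"
| "or_sat e (Exists p) \<longleftrightarrow> (\<exists>x. or_sat (case_nat x e) p)"

text \<open>
  The element tested for membership is variable \<open>0\<close>, the parameters are the values \<open>c 0, c 1, \<dots>\<close> of
  the remaining variables; a formula mentions only finitely many of them.
\<close>

definition or_definable :: "'a::{zero,one,plus,uminus,times,ord} set \<Rightarrow> bool" where
  "or_definable S \<longleftrightarrow> (\<exists>p c. S = {x. or_sat (case_nat x c) p})"

text \<open>
  The type \<open>'g extended\<close> also has a least element \<open>Minf\<close>, which is excluded as a value.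
  The map is not required to be onto: the value group is the subgroup of all finite values of
  \<open>v\<close>.
\<close>

definition is_valuation :: "('a::field \<Rightarrow> 'g::linordered_ab_group_add extended) \<Rightarrow> bool" where
  "is_valuation v \<longleftrightarrow>
     (\<forall>x. v x \<noteq> Minf) \<and>
     (\<forall>x. v x = Pinf \<longleftrightarrow> x = 0) \<and>
     (\<forall>x y. v (x * y) = v x + v y) \<and>
     (\<forall>x y. min (v x) (v y) \<le> v (x + y))"

definition valuation_ring :: "('a::field \<Rightarrow> 'g::linordered_ab_group_add extended) \<Rightarrow> 'a set" where
  "valuation_ring v = {x. 0 \<le> v x}"

definition henselian :: "('a::field \<Rightarrow> 'g::linordered_ab_group_add extended) \<Rightarrow> bool" where
  "henselian v \<longleftrightarrow>
     is_valuation v \<and>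
     (\<forall>f a. (\<forall>i. coeff f i \<in> valuation_ring v) \<and> a \<in> valuation_ring v \<and>
            0 < v (poly f a) \<and> v (poly (pderiv f) a) = 0 \<longrightarrow>
       (\<exists>b \<in> valuation_ring v. poly f b = 0 \<and> 0 < v (b - a)))"

definition comparable ::
  "('a::field \<Rightarrow> 'g::linordered_ab_group_add extended) \<Rightarrow>
   ('a \<Rightarrow> 'h::linordered_ab_group_add extended) \<Rightarrow> bool" where
  "comparable v w \<longleftrightarrow>
     valuation_ring v \<subseteq> valuation_ring w \<or> valuation_ring w \<subseteq> valuation_ring v"

end

theory Submission
  imports Defs
begin

text \<open>
  By Hensel's lemma and residue characteristic zero, if \<open>a\<close> is the element closest to \<open>y\<close> among the roots
  in \<open>K\<close> of a polynomial \<open>f\<close> and all its derivatives, then the Taylor expansion of \<open>f(y)\<close> at \<open>a\<close> has no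
  cancellation. Hence the leading term of \<open>f(y)\<close> depends only on that of \<open>y - a\<close> and those of the
  derivatives of \<open>f\<close> at \<open>a\<close>. This makes a back-and-forth argument work in which leading terms are
  preserved exactly: every formula is decided by the leading terms of finitely many polynomials in its
  variables, the order being visible in the leading term because \<open>1 + \<mm>\<close> consists of squares.
  Consequently a definable set is constant on the ball \<open>v(x' - x) > max\<^sub>a v(x - a)\<close> for a finite
  exceptional set of points \<open>a\<close>. If \<open>v\<close> and \<open>w\<close> are incomparable there is \<open>\<gamma>\<close> with
  \<open>v \<gamma> > 0 > w \<gamma>\<close>. Powers of \<open>\<theta> = \<gamma>\<^sup>-\<^sup>1\<close> are at pairwise negative \<open>v\<close>-distance, so
  some \<open>\<theta>\<^sup>n\<close> is at negative \<open>v\<close>-distance from all exceptional points. Then \<open>\<theta>\<^sup>n\<close> and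
  \<open>\<theta>\<^sup>n + \<gamma>\<close> lie in one such ball, but only the first one lies in the valuation ring of \<open>w\<close>.
\<close>

section \<open>Elementary properties of valuations\<close>

lemma valuation_Fin:
  assumes "is_valuation v" "x \<noteq> 0"
  obtains g where "v x = Fin g"
  using assms unfolding is_valuation_def by (metis extended.exhaust)

lemma valuation_1: "is_valuation v \<Longrightarrow> v 1 = 0"
proof -
  assume v: "is_valuation v"
  obtain g where g: "v 1 = Fin g" using valuation_Fin[OF v, of 1] by auto
  have "v 1 = v 1 + v 1" using v unfolding is_valuation_def by (metis mult_1)
  then show ?thesis using g by (simp add: zero_extended_def)
qed

text \<open>Doubling \<open>v (- 1)\<close> gives \<open>v 1 = 0\<close>, and a linearly ordered
  group has no torsion.\<close>

lemma valuation_minus: "is_valuation v \<Longrightarrow> v (- x) = v x"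
proof -
  assume v: "is_valuation v"
  obtain g where g: "v (- 1) = Fin g" using valuation_Fin[OF v, of "- 1"] by auto
  have "v (- 1) + v (- 1) = v (- 1 * - 1)" using v unfolding is_valuation_def by metis
  then have "g + g = 0" using g valuation_1[OF v] by (simp add: zero_extended_def)
  then have "v (- 1) = 0" using g by (simp add: zero_extended_def)
  moreover have "v (- x) = v (- 1) + v x" using v unfolding is_valuation_def by (metis mult_minus1)
  ultimately show ?thesis by simp
qed

lemma valuation_less_iff:
  assumes "is_valuation v" "c \<noteq> 0"
  shows "v (c * x) < v (c * y) \<longleftrightarrow> v x < v y"
proof -
  obtain g where g: "v c = Fin g" using valuation_Fin[OF assms] .
  have *: "v (c * z) = v c + v z" for z using assms unfolding is_valuation_def by metis
  have "v x \<noteq> Minf" "v y \<noteq> Minf" using assms unfolding is_valuation_def by auto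
  then show ?thesis unfolding * g by (cases "v x"; cases "v y") auto
qed

locale valued =
  fixes v :: "'a::field \<Rightarrow> 'g::linordered_ab_group_add extended"
  assumes val: "is_valuation v"
begin

lemma v_mult: "v (x * y) = v x + v y"
  and v_add: "min (v x) (v y) \<le> v (x + y)"
  and v_Pinf: "v x = Pinf \<longleftrightarrow> x = 0"
  using val unfolding is_valuation_def by auto

lemma v_0: "v 0 = Pinf" using v_Pinf by simp

lemma v_0_le_iff: "v 0 \<le> v x \<longleftrightarrow> x = 0" by (simp add: v_0 v_Pinf)

lemmas v_1 = valuation_1[OF val]
  and v_minus = valuation_minus[OF val]
  and v_less_iff = valuation_less_iff[OF val]

lemma v_le_iff: "c \<noteq> 0 \<Longrightarrow> v (c * x) \<le> v (c * y) \<longleftrightarrow> v x \<le> v y"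
  using v_less_iff by (metis not_le)

lemma v_add_gt: "g < v x \<Longrightarrow> g < v y \<Longrightarrow> g < v (x + y)"
  using v_add[of x y] by (meson less_le_trans min_less_iff_conj)

lemma v_add_ge: "g \<le> v x \<Longrightarrow> g \<le> v y \<Longrightarrow> g \<le> v (x + y)"
  using v_add[of x y] by (meson order_trans min.bounded_iff)

lemma v_diff_commute: "v (x - y) = v (y - x)"
  using v_minus[of "x - y"] by simp

lemma v_eqI: "v x < v (x - y) \<Longrightarrow> v x = v y"
proof (rule antisym)
  assume *: "v x < v (x - y)"
  then show "v x \<le> v y" using v_add_ge[of "v x" x "y - x"] by (simp add: v_diff_commute less_imp_le)
  show "v y \<le> v x"
  proof (rule ccontr)
    assume "\<not> v y \<le> v x"
    then have "v x < v x" using v_add_gt[of "v x" y "x - y"] * by (simp add: not_le)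
    then show False by simp
  qed
qed

lemma v_add_eq: "v x < v y \<Longrightarrow> v (x + y) = v x"
  using v_eqI[of x "x + y"] v_minus[of y] by simp

lemma v_sum_gt:
  assumes "\<And>i. i \<in> I \<Longrightarrow> g < v (f i)" "g < Pinf"
  shows "g < v (sum f I)"
  using assms by (induction I rule: infinite_finite_induct) (auto simp: v_0 intro: v_add_gt)

lemma v_mult_gt0: "0 < v x \<Longrightarrow> 0 \<le> v y \<Longrightarrow> 0 < v (x * y)"
  using v_le_iff[of x 1 y] v_1 v_0 by (cases "x = 0") (auto simp: less_le_trans)

lemma v_mult_ge0: "0 \<le> v x \<Longrightarrow> 0 \<le> v y \<Longrightarrow> 0 \<le> v (x * y)"
  using add_mono[of 0 "v x" 0 "v y"] by (simp add: v_mult)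

lemma v_of_nat_ge0: "0 \<le> v (of_nat n)"
  by (induction n) (auto simp: v_0 v_1 intro: v_add_ge)

lemma v_div_gt0_iff: "c \<noteq> 0 \<Longrightarrow> 0 < v (x / c) \<longleftrightarrow> v c < v x"
  using v_less_iff[of c 1 "x / c"] v_1 by simp

lemma v_div_ge0_iff: "c \<noteq> 0 \<Longrightarrow> 0 \<le> v (x / c) \<longleftrightarrow> v c \<le> v x"
  using v_le_iff[of c 1 "x / c"] v_1 by simp

lemma v_poly_ge0: "(\<And>k. 0 \<le> v (coeff p k)) \<Longrightarrow> 0 \<le> v x \<Longrightarrow> 0 \<le> v (poly p x)"
proof (induction p)
  case (pCons a p)
  have "0 \<le> v a" using pCons.prems(1)[of 0] by simp
  moreover have "0 \<le> v (poly p x)"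
    using pCons.prems(1)[of "Suc _"] by (intro pCons.IH) (auto simp: pCons.prems)
  ultimately show ?case using pCons.prems(2) by (simp add: v_add_ge v_mult_ge0)
qed (simp add: v_0)

lemma v_poly_gt0: "(\<And>k. 0 < v (coeff p k)) \<Longrightarrow> 0 \<le> v x \<Longrightarrow> 0 < v (poly p x)"
proof (induction p)
  case (pCons a p)
  have "0 < v a" using pCons.prems(1)[of 0] by simp
  moreover have "0 < v (poly p x)"
    using pCons.prems(1)[of "Suc _"] by (intro pCons.IH) (auto simp: pCons.prems)
  then have "0 < v (x * poly p x)" using v_mult_gt0[of "poly p x" x] pCons.prems(2) by (simp add: mult.commute)
  ultimately show ?case by (simp add: v_add_gt)
qed (simp add: v_0 zero_extended_def)

text \<open>By Horner's scheme the shifted coefficients are combinations of the old ones with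
  integral factors. This allows an integral change of centre within the polynomials over the maximal
  ideal.\<close>

lemma v_pcompose_shift_gt0:
  assumes "\<And>k. 0 < v (coeff p k)" "0 \<le> v x"
  shows "0 < v (coeff (pcompose p [:x, 1:]) k)"
  using assms(1)
proof (induction p arbitrary: k)
  case (pCons a p)
  have a: "0 < v a" using pCons.prems(1)[of 0] by simp
  have p: "0 < v (coeff (pcompose p [:x, 1:]) k)" for k
    using pCons.prems(1)[of "Suc _"] by (intro pCons.IH) auto
  have "0 < v (coeff (pCons a 0) k)" for k
    using a by (cases k) (auto simp: v_0 zero_extended_def)
  moreover have "0 < v (coeff (pCons 0 (pcompose p [:x, 1:])) k)" for k
    using p by (cases k) (auto simp: v_0 zero_extended_def)
  moreover have "0 < v (x * coeff (pcompose p [:x, 1:]) k)" for k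
    using v_mult_gt0[OF p assms(2)] by (simp add: mult.commute)
  ultimately show ?case by (simp add: pcompose_pCons v_add_gt)
qed (simp add: v_0 zero_extended_def)

section \<open>Leading terms and their arithmetic\<close>

text \<open>\<open>rveq x y\<close> says that \<open>x\<close> and \<open>y\<close> have the same leading term, that is, the same class modulo
  \<open>1 + \<mm>\<close>, where \<open>\<mm>\<close> is the maximal ideal of the valuation ring.\<close>

definition rveq :: "'a \<Rightarrow> 'a \<Rightarrow> bool" where
  "rveq x y \<longleftrightarrow> x = y \<or> v x < v (x - y)"

lemma rveq_refl [simp]: "rveq x x" by (simp add: rveq_def)

lemma rveq_v: "rveq x y \<Longrightarrow> v x = v y"
  unfolding rveq_def using v_eqI by blast

lemma rveq_sym: "rveq x y \<Longrightarrow> rveq y x"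
  using rveq_v[of x y] v_diff_commute[of x y] by (auto simp: rveq_def)

lemma rveq_trans: "rveq x y \<Longrightarrow> rveq y z \<Longrightarrow> rveq x z"
  using rveq_v[of x y] v_add_gt[of "v x" "x - y" "y - z"] by (auto simp: rveq_def)

lemma rveq_zero: "rveq x y \<Longrightarrow> x = 0 \<longleftrightarrow> y = 0"
  using rveq_v[of x y] v_Pinf by metis

lemma rveq_mult_left_iff: "c \<noteq> 0 \<Longrightarrow> rveq (c * x) (c * y) \<longleftrightarrow> rveq x y"
  using v_less_iff[of c x "x - y"] by (auto simp: rveq_def right_diff_distrib)

lemma rveq_mult: "rveq x y \<Longrightarrow> rveq x' y' \<Longrightarrow> rveq (x * x') (y * y')"
proof -
  assume *: "rveq x y" "rveq x' y'"
  have "rveq (x * x') (x * y')" using *(2) rveq_mult_left_iff[of x] by (cases "x = 0") auto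
  moreover have "rveq (y' * x) (y' * y)" using *(1) rveq_mult_left_iff[of y'] by (cases "y' = 0") auto
  ultimately show ?thesis by (metis rveq_trans mult.commute)
qed

lemma rveq_power: "rveq x y \<Longrightarrow> rveq (x ^ n) (y ^ n)"
  by (induction n) (auto intro: rveq_mult)

text \<open>Serves to remove the factors that pseudo-division introduces.\<close>

lemma rveq_mult_cancel:
  assumes "rveq c c'" "c \<noteq> 0" "rveq (c * x) (c' * y)"
  shows "rveq x y"
proof -
  have "rveq (c * y) (c' * y)" using assms(1) by (intro rveq_mult) auto
  then show ?thesis using assms rveq_mult_left_iff rveq_sym rveq_trans by blast
qed

text \<open>The hypothesis \<open>le\<close> expresses that nothing cancels: each error
  \<open>s i - s' i\<close> has value above that of \<open>s i\<close>, hence above that of the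
  whole sum, and so do the errors together. If the sum is 0, the hypothesis forces every summand to
  be 0.\<close>

lemma rveq_sum:
  assumes "\<And>i. i \<in> I \<Longrightarrow> rveq (s i) (s' i)"
    and le: "\<And>i. i \<in> I \<Longrightarrow> v (sum s I) \<le> v (s i)"
  shows "rveq (sum s I) (sum s' I)"
proof (cases "sum s I = 0")
  case True
  then have "s i = 0" if "i \<in> I" for i using le[OF that] v_0 v_Pinf by simp
  then have "s' i = 0" if "i \<in> I" for i using assms(1)[OF that] rveq_zero that by blast
  then show ?thesis using True by simp
next
  case False
  then have fin: "v (sum s I) < Pinf" using v_Pinf by (simp add: order.strict_iff_order)
  have "v (sum s I) < v (s i - s' i)" if "i \<in> I" for i
    using assms(1)[OF that] le[OF that] fin by (auto simp: rveq_def v_0)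
  then have "v (sum s I) < v (\<Sum>i\<in>I. s i - s' i)" using fin by (intro v_sum_gt)
  then show ?thesis by (simp add: rveq_def sum_subtractf)
qed

end

section \<open>Taylor expansion and linear substitution\<close>

lemma higher_pderiv_pcompose_linear:
  fixes f :: "'a::idom poly"
  shows "(pderiv ^^ k) (pcompose f [:a, t:]) = smult (t ^ k) (pcompose ((pderiv ^^ k) f) [:a, t:])"
  by (induction k) (simp_all add: pderiv_smult pderiv_pcompose pderiv_pCons mult.commute)

lemma coeff_pcompose_taylor:
  fixes f :: "'a::field_char_0 poly"
  shows "coeff (pcompose f [:a, t:]) k = t ^ k * poly ((pderiv ^^ k) f) a / fact k"
proof -
  have "coeff ((pderiv ^^ k) (pcompose f [:a, t:])) 0 = t ^ k * poly ((pderiv ^^ k) f) a"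
    by (simp add: higher_pderiv_pcompose_linear)
  then show ?thesis by (simp add: coeff_higher_pderiv pochhammer_fact[symmetric] field_simps)
qed

lemma poly_higher_pderiv_pcompose:
  fixes f :: "'a::idom poly"
  shows "poly ((pderiv ^^ k) (pcompose f [:a, t:])) x = t ^ k * poly ((pderiv ^^ k) f) (a + t * x)"
  by (simp add: higher_pderiv_pcompose_linear poly_pcompose mult.commute)

lemma poly_eq_sum_le:
  fixes p :: "'a::comm_semiring_1 poly"
  assumes "degree p \<le> n"
  shows "poly p x = (\<Sum>k\<le>n. coeff p k * x ^ k)"
  unfolding poly_altdef[of p x] using assms by (intro sum.mono_neutral_left) (auto simp: coeff_eq_0)

text \<open>The rescaled polynomial f(a + (y - a)X) is evaluated at X = 1, so that its coefficients
  are the Taylor summands themselves.\<close>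

lemma poly_taylor:
  fixes f :: "'a::field_char_0 poly"
  assumes "degree f \<le> n"
  shows "poly f y = (\<Sum>k\<le>n. (y - a) ^ k * poly ((pderiv ^^ k) f) a / fact k)"
proof -
  have "degree (pcompose f [:a, y - a:]) \<le> n"
    using assms degree_pcompose_le[of f "[:a, y - a:]"] by (auto split: if_splits)
  from poly_eq_sum_le[OF this, of 1] show ?thesis
    by (simp add: poly_pcompose coeff_pcompose_taylor)
qed

section \<open>Terms as functions, and polynomials with term coefficients\<close>

text \<open>These are the integer polynomials in the variables, taken as functions of the
  environment so that closure properties can be used without handling syntax.\<close>

definition term_funs :: "((nat \<Rightarrow> 'a::linordered_field) \<Rightarrow> 'a) set" where
  "term_funs = {f. \<exists>t. \<forall>e. f e = or_eval e t}"

lemma term_funsI: "(\<And>e. f e = or_eval e t) \<Longrightarrow> f \<in> term_funs"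
  by (auto simp: term_funs_def)

lemma term_funs_var: "(\<lambda>e. e i) \<in> term_funs"
  by (rule term_funsI[of _ "Var i"]) simp

lemma term_funs_0: "(\<lambda>e. 0) \<in> term_funs"
  by (rule term_funsI[of _ Zero]) simp

lemma term_funs_1: "(\<lambda>e. 1) \<in> term_funs"
  by (rule term_funsI[of _ One]) simp

lemma term_funs_add: "f \<in> term_funs \<Longrightarrow> g \<in> term_funs \<Longrightarrow> (\<lambda>e. f e + g e) \<in> term_funs"
  unfolding term_funs_def mem_Collect_eq by (metis or_eval.simps(4))

lemma term_funs_mult: "f \<in> term_funs \<Longrightarrow> g \<in> term_funs \<Longrightarrow> (\<lambda>e. f e * g e) \<in> term_funs"
  unfolding term_funs_def mem_Collect_eq by (metis or_eval.simps(6))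

lemma term_funs_minus: "f \<in> term_funs \<Longrightarrow> (\<lambda>e. - f e) \<in> term_funs"
  unfolding term_funs_def mem_Collect_eq by (metis or_eval.simps(5))

lemma term_funs_diff: "f \<in> term_funs \<Longrightarrow> g \<in> term_funs \<Longrightarrow> (\<lambda>e. f e - g e) \<in> term_funs"
  using term_funs_add[OF _ term_funs_minus] by fastforce

lemma term_funs_of_nat: "(\<lambda>e. of_nat n) \<in> term_funs"
  by (induction n) (auto intro: term_funs_0 term_funs_1 term_funs_add)

lemma term_funs_power: "f \<in> term_funs \<Longrightarrow> (\<lambda>e. f e ^ n) \<in> term_funs"
  by (induction n) (auto intro: term_funs_1 term_funs_mult)

lemma term_funs_sum: "(\<And>i. i \<in> I \<Longrightarrow> f i \<in> term_funs) \<Longrightarrow> (\<lambda>e. \<Sum>i\<in>I. f i e) \<in> term_funs"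
  by (induction I rule: infinite_finite_induct) (auto intro: term_funs_0 term_funs_add)

lemma term_funs_subst:
  assumes "f \<in> term_funs" "\<And>n. (\<lambda>e. s e n) \<in> term_funs"
  shows "(\<lambda>e. f (s e)) \<in> term_funs"
proof -
  obtain t where f: "f = (\<lambda>e. or_eval e t)" using assms(1) by (auto simp: term_funs_def)
  show ?thesis unfolding f
    by (induction t)
      (auto intro: assms(2) term_funs_0 term_funs_1 term_funs_add term_funs_minus term_funs_mult)
qed

text \<open>The bound \<open>n\<close> is a formal degree, uniform in the environment; the true
  degree drops where leading coefficients vanish.\<close>

definition poly_funs :: "nat \<Rightarrow> ((nat \<Rightarrow> 'a::linordered_field) \<Rightarrow> 'a poly) set" where
  "poly_funs n = {P. (\<forall>e. degree (P e) \<le> n) \<and> (\<forall>k. (\<lambda>e. coeff (P e) k) \<in> term_funs)}"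

lemma poly_funsI:
  "(\<And>e k. n < k \<Longrightarrow> coeff (P e) k = 0) \<Longrightarrow> (\<And>k. (\<lambda>e. coeff (P e) k) \<in> term_funs) \<Longrightarrow> P \<in> poly_funs n"
  by (auto simp: poly_funs_def intro: degree_le)

lemma poly_funs_degree: "P \<in> poly_funs n \<Longrightarrow> degree (P e) \<le> n"
  and poly_funs_coeff: "P \<in> poly_funs n \<Longrightarrow> (\<lambda>e. coeff (P e) k) \<in> term_funs"
  by (auto simp: poly_funs_def)

lemma poly_funs_coeff_eq_0: "P \<in> poly_funs n \<Longrightarrow> n < k \<Longrightarrow> coeff (P e) k = 0"
  using poly_funs_degree[of P n e] by (simp add: coeff_eq_0)

lemma poly_funs_mono: "P \<in> poly_funs m \<Longrightarrow> m \<le> n \<Longrightarrow> P \<in> poly_funs n"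
  unfolding poly_funs_def by (auto intro: order_trans)

lemma poly_funs_const: "f \<in> term_funs \<Longrightarrow> (\<lambda>e. [:f e:]) \<in> poly_funs 0"
  by (rule poly_funsI; case_tac k) (auto intro: term_funs_0)

lemma poly_funs_X: "(\<lambda>e. [:0, 1:]) \<in> poly_funs 1"
  by (rule poly_funsI; case_tac k) (auto simp: coeff_pCons intro: term_funs_0 term_funs_1 split: nat.split)

lemma poly_funs_add: "P \<in> poly_funs n \<Longrightarrow> Q \<in> poly_funs n \<Longrightarrow> (\<lambda>e. P e + Q e) \<in> poly_funs n"
  by (rule poly_funsI) (auto simp: poly_funs_coeff_eq_0 intro: term_funs_add poly_funs_coeff)

lemma poly_funs_minus: "P \<in> poly_funs n \<Longrightarrow> (\<lambda>e. - P e) \<in> poly_funs n"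
  by (rule poly_funsI) (auto simp: poly_funs_coeff_eq_0 intro: term_funs_minus poly_funs_coeff)

lemma poly_funs_mult:
  assumes "P \<in> poly_funs m" "Q \<in> poly_funs n"
  shows "(\<lambda>e. P e * Q e) \<in> poly_funs (m + n)"
proof (rule poly_funsI)
  show "(\<lambda>e. coeff (P e * Q e) k) \<in> term_funs" for k
    unfolding coeff_mult using assms by (intro term_funs_sum term_funs_mult poly_funs_coeff)
  show "coeff (P e * Q e) k = 0" if "m + n < k" for e k
    using that degree_mult_le[of "P e" "Q e"] poly_funs_degree[OF assms(1), of e]
      poly_funs_degree[OF assms(2), of e] by (intro coeff_eq_0) linarith
qed

lemma poly_funs_higher_pderiv: "P \<in> poly_funs n \<Longrightarrow> (\<lambda>e. (pderiv ^^ k) (P e)) \<in> poly_funs n"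
proof (induction k)
  case (Suc k)
  then have IH: "(\<lambda>e. (pderiv ^^ k) (P e)) \<in> poly_funs n" by simp
  show ?case
    by (rule poly_funsI)
      (auto simp: coeff_pderiv poly_funs_coeff_eq_0[OF IH] simp del: of_nat_Suc
        intro!: term_funs_mult term_funs_of_nat poly_funs_coeff[OF IH])
qed simp

lemma poly_funs_pderiv: "P \<in> poly_funs (Suc n) \<Longrightarrow> (\<lambda>e. pderiv (P e)) \<in> poly_funs n"
  by (rule poly_funsI)
    (auto simp: coeff_pderiv poly_funs_coeff_eq_0 simp del: of_nat_Suc
      intro!: term_funs_mult term_funs_of_nat poly_funs_coeff)

text \<open>The argument becomes variable 0 and the coefficients see the shifted variables, in
  accordance with \<open>case_nat\<close>.\<close>

lemma poly_funs_poly: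
  assumes "P \<in> poly_funs n"
  shows "(\<lambda>e. poly (P (\<lambda>i. e (Suc i))) (e 0)) \<in> term_funs"
  unfolding poly_eq_sum_le[OF poly_funs_degree[OF assms]]
  by (intro term_funs_sum term_funs_mult term_funs_power term_funs_var
      term_funs_subst[OF poly_funs_coeff[OF assms]])

lemma term_funs_as_poly:
  fixes f :: "(nat \<Rightarrow> 'a::linordered_field) \<Rightarrow> 'a"
  assumes "f \<in> term_funs"
  shows "\<exists>n. \<exists>P \<in> poly_funs n. \<forall>y e. f (case_nat y e) = poly (P e) y"
proof -
  obtain t where f: "f = (\<lambda>e. or_eval e t)" using assms by (auto simp: term_funs_def)
  show ?thesis unfolding f
  proof (induction t)
    case (Var i)
    then show ?case
    proof (cases i)
      case 0
      then show ?thesis using poly_funs_X by (intro exI[of _ 1] bexI[of _ "\<lambda>e. [:0, 1:]"]) auto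
    next
      case (Suc j)
      then show ?thesis using poly_funs_const[OF term_funs_var[of j]]
        by (intro exI[of _ 0] bexI[of _ "\<lambda>e. [:e j:]"]) auto
    qed
  next
    case Zero
    then show ?case using poly_funs_const[OF term_funs_0]
      by (intro exI[of _ 0] bexI[of _ "\<lambda>e. [:0:]"]) auto
  next
    case One
    then show ?case using poly_funs_const[OF term_funs_1]
      by (intro exI[of _ 0] bexI[of _ "\<lambda>e. [:1:]"]) auto
  next
    case (Add s t)
    from Add.IH(1) obtain m and P :: "(nat \<Rightarrow> 'a) \<Rightarrow> 'a poly"
      where P: "P \<in> poly_funs m" "\<And>y e. or_eval (case_nat y e) s = poly (P e) y" by blast
    from Add.IH(2) obtain n and Q :: "(nat \<Rightarrow> 'a) \<Rightarrow> 'a poly"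
      where Q: "Q \<in> poly_funs n" "\<And>y e. or_eval (case_nat y e) t = poly (Q e) y" by blast
    have "(\<lambda>e. P e + Q e) \<in> poly_funs (max m n)"
      by (intro poly_funs_add poly_funs_mono[OF P(1)] poly_funs_mono[OF Q(1)]) auto
    then show ?case using P(2) Q(2) by (intro exI bexI[of _ "\<lambda>e. P e + Q e"]) auto
  next
    case (Neg t)
    then obtain n and Q :: "(nat \<Rightarrow> 'a) \<Rightarrow> 'a poly"
      where "Q \<in> poly_funs n" "\<And>y e. or_eval (case_nat y e) t = poly (Q e) y" by blast
    then show ?case using poly_funs_minus[of Q n] by (intro exI bexI[of _ "\<lambda>e. - Q e"]) auto
  next
    case (Mul s t)
    from Mul.IH(1) obtain m and P :: "(nat \<Rightarrow> 'a) \<Rightarrow> 'a poly"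
      where P: "P \<in> poly_funs m" "\<And>y e. or_eval (case_nat y e) s = poly (P e) y" by blast
    from Mul.IH(2) obtain n and Q :: "(nat \<Rightarrow> 'a) \<Rightarrow> 'a poly"
      where Q: "Q \<in> poly_funs n" "\<And>y e. or_eval (case_nat y e) t = poly (Q e) y" by blast
    then show ?case using poly_funs_mult[OF P(1) Q(1)] P(2) Q(2)
      by (intro exI bexI[of _ "\<lambda>e. P e * Q e"]) auto
  qed
qed

lemma term_funs_as_polys:
  assumes "finite F" "F \<subseteq> term_funs"
  obtains P n where "\<And>f. f \<in> F \<Longrightarrow> P f \<in> poly_funs n"
    "\<And>f y e. f \<in> F \<Longrightarrow> f (case_nat y e) = poly (P f e) y"
proof -
  have "\<forall>f\<in>F. \<exists>n P. P \<in> poly_funs n \<and> (\<forall>y e. f (case_nat y e) = poly (P e) y)"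
  proof
    fix f assume "f \<in> F"
    then have "f \<in> term_funs" using assms(2) by blast
    from term_funs_as_poly[OF this] show "\<exists>n P. P \<in> poly_funs n \<and> (\<forall>y e. f (case_nat y e) = poly (P e) y)"
      by (simp only: Bex_def)
  qed
  from bchoice[OF this] obtain N
    where "\<forall>f\<in>F. \<exists>P. P \<in> poly_funs (N f) \<and> (\<forall>y e. f (case_nat y e) = poly (P e) y)" by (rule exE)
  from bchoice[OF this] obtain P
    where NP: "\<forall>f\<in>F. P f \<in> poly_funs (N f) \<and> (\<forall>y e. f (case_nat y e) = poly (P f e) y)" by (rule exE)
  have "P f \<in> poly_funs (Max (N ` F))" if "f \<in> F" for f
  proof (rule poly_funs_mono)
    show "P f \<in> poly_funs (N f)" using NP that by blast
    show "N f \<le> Max (N ` F)" using that assms(1) by simp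
  qed
  moreover have "f (case_nat y e) = poly (P f e) y" if "f \<in> F" for f y e
    using bspec[OF NP that] by blast
  ultimately show thesis by (rule that)
qed

text \<open>Pseudo-division multiplies by the formal leading coefficient of \<open>f\<close> instead
  of dividing by it, so the remainder keeps term coefficients. The exponent \<open>N\<close> does
  not depend on the environment, and the identity also holds where that coefficient
  vanishes.\<close>

lemma poly_funs_pseudo_mod:
  assumes f: "f \<in> poly_funs (Suc m)" and "g \<in> poly_funs n"
  shows "\<exists>N. \<exists>r\<in>poly_funs m. \<forall>e. \<exists>q. smult (coeff (f e) (Suc m) ^ N) (g e) = q * f e + r e"
  using assms(2)
proof (induction n arbitrary: g)
  case 0
  then have "g \<in> poly_funs m" by (rule poly_funs_mono) simp
  then show ?case by (intro exI[of _ 0] bexI[of _ g]) (auto intro: exI[of _ 0])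
next
  case (Suc n)
  show ?case
  proof (cases "Suc n \<le> m")
    case True
    with Suc.prems have "g \<in> poly_funs m" by (rule poly_funs_mono)
    then show ?thesis by (intro exI[of _ 0] bexI[of _ g]) (auto intro: exI[of _ 0])
  next
    case False
    let ?c = "\<lambda>e. coeff (f e) (Suc m)" and ?d = "\<lambda>e. monom (coeff (g e) (Suc n)) (n - m)"
    \<comment> \<open>The formal leading terms, both of degree \<open>Suc n\<close>, cancel, so the
      induction hypothesis applies to this polynomial.\<close>
    let ?g = "\<lambda>e. smult (?c e) (g e) - ?d e * f e"
    have "?g \<in> poly_funs n"
    proof (rule poly_funsI)
      fix e k assume "n < k"
      then consider "k = Suc n" | "Suc n < k" by linarith
      then show "coeff (?g e) k = 0"
      proof cases
        case 1
        then show ?thesis using False by (simp add: coeff_monom_mult Suc_diff_le)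
      next
        case 2
        then have "Suc m < k - (n - m)" using False by linarith
        then show ?thesis using 2 f Suc.prems
          by (simp add: coeff_monom_mult poly_funs_coeff_eq_0[OF f] poly_funs_coeff_eq_0[OF Suc.prems])
      qed
    next
      fix k
      show "(\<lambda>e. coeff (?g e) k) \<in> term_funs"
        using term_funs_diff[OF term_funs_mult[OF poly_funs_coeff[OF f] poly_funs_coeff[OF Suc.prems]]
            term_funs_mult[OF poly_funs_coeff[OF Suc.prems] poly_funs_coeff[OF f]]]
          term_funs_mult[OF poly_funs_coeff[OF f] poly_funs_coeff[OF Suc.prems]]
        by (cases "n - m \<le> k") (simp_all add: coeff_monom_mult)
    qed
    from Suc.IH[OF this] obtain N r where r: "r \<in> poly_funs m"
      and N: "\<forall>e. \<exists>q. smult (?c e ^ N) (?g e) = q * f e + r e" by (elim exE bexE)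
    have "\<exists>q. smult (?c e ^ Suc N) (g e) = q * f e + r e" for e
    proof -
      obtain q where "smult (?c e ^ N) (?g e) = q * f e + r e" using spec[OF N] by (rule exE)
      then have "smult (?c e ^ Suc N) (g e) = (q + smult (?c e ^ N) (?d e)) * f e + r e"
        by (simp add: smult_diff_right algebra_simps)
      then show ?thesis by (rule exI)
    qed
    then show ?thesis using r by (intro exI[of _ "Suc N"] bexI[of _ r] allI)
  qed
qed

section \<open>Consequences of Hensel's lemma in an ordered field\<close>

lemma finite_ex_max:
  fixes g :: "'b \<Rightarrow> 'c::linorder"
  assumes "finite A" "A \<noteq> {}"
  obtains a where "a \<in> A" "\<And>b. b \<in> A \<Longrightarrow> g b \<le> g a"
proof -
  have fin: "finite (g ` A)" "g ` A \<noteq> {}" using assms by auto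
  from Max_in[OF this] obtain a where a: "Max (g ` A) = g a" "a \<in> A" by (rule imageE)
  have "g b \<le> g a" if "b \<in> A" for b
    unfolding a(1)[symmetric] using that fin(1) by simp
  with a(2) show thesis by (rule that)
qed

locale henselian_ordered = valued v
  for v :: "'a::linordered_field \<Rightarrow> 'g::linordered_ab_group_add extended" +
  assumes henselian: "henselian v"
begin

lemma hensel:
  assumes "\<And>i. 0 \<le> v (coeff f i)" "0 \<le> v a" "0 < v (poly f a)" "v (poly (pderiv f) a) = 0"
  obtains b where "poly f b = 0" "0 < v (b - a)"
  using henselian assms unfolding henselian_def valuation_ring_def by blast

text \<open>Otherwise Hensel's lemma yields a root of \<open>X\<^sup>2 + X + n\<close>, whose discriminant is negative.\<close>

lemma v_of_nat:
  assumes "0 < n"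
  shows "v (of_nat n) = 0"
proof (rule ccontr)
  assume "v (of_nat n) \<noteq> 0"
  then have "0 < v (of_nat n)" using v_of_nat_ge0[of n] by (metis order.not_eq_order_implies_strict)
  moreover have "0 \<le> v (coeff [:of_nat n, 1, 1:] i)" for i
    using v_of_nat_ge0[of n] by (auto simp: coeff_pCons v_0 v_1 split: nat.split)
  moreover have "v 0 \<ge> 0" by (simp add: v_0)
  ultimately obtain b where "poly [:of_nat n, 1, 1:] b = 0" "0 < v (b - 0)"
    using hensel[of "[:of_nat n, 1, 1:]" 0] by (auto simp: v_1 pderiv_pCons)
  then have "(2 * b + 1) * (2 * b + 1) + (4 * of_nat n - 1) = 0" by (simp add: algebra_simps)
  moreover have "(of_nat n :: 'a) \<ge> 1" using assms by (metis Suc_leI of_nat_1 of_nat_mono One_nat_def)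
  then have "(4 * of_nat n - 1 :: 'a) > 0" by linarith
  ultimately show False using zero_le_square[of "2 * b + 1"] by linarith
qed

lemma v_fact: "v (fact k) = 0"
  using v_of_nat[of "fact k"] by simp

text \<open>The quotient y/x has the form 1 + m with \<open>0 < v m\<close>. Modulo the maximal
  ideal, 1 is a simple root of X^2 - (1 + m), as 2 is a unit by \<open>v_of_nat\<close>. Hence y/x
  is a square and cannot be negative.\<close>

lemma rveq_pos:
  assumes "rveq x y" "0 < x"
  shows "0 < y"
proof (cases "x = y")
  case False
  define m where "m = (y - x) / x"
  have "v (x * 1) < v (x * m)"
    using assms False v_diff_commute[of x y] by (simp add: rveq_def m_def)
  then have m: "0 < v m" using v_less_iff assms(2) v_1 by (metis less_irrefl)
  let ?f = "[:- (1 + m), 0, 1:]"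
  have "0 \<le> v (1 + m)" using m v_1 by (intro v_add_ge) auto
  then have "0 \<le> v (- (1 + m))" by (simp only: v_minus)
  then have "0 \<le> v (coeff ?f i)" for i
    by (auto simp: coeff_pCons v_0 v_1 simp del: minus_add_distrib split: nat.split)
  moreover have "poly ?f 1 = - m" "poly (pderiv ?f) 1 = of_nat 2"
    by (simp_all add: pderiv_pCons)
  then have "0 < v (poly ?f 1)" "v (poly (pderiv ?f) 1) = 0"
    using m v_of_nat[of 2] by (simp_all only: v_minus)
  ultimately obtain b where "poly ?f b = 0"
    using hensel[of ?f 1] v_1 by auto
  then have "b * b = y / x" using assms(2) by (simp add: m_def field_simps)
  then have "0 \<le> y / x" by (metis zero_le_square)
  moreover have "y \<noteq> 0" using rveq_zero[OF assms(1)] assms(2) by auto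
  ultimately show ?thesis using assms(2) by (simp add: zero_le_divide_iff)
qed (use assms in simp)

section \<open>Taylor expansion at a closest root\<close>

text \<open>Factorials are units, so the Taylor coefficients at \<open>x\<close> lie in the maximal
  ideal; shifting back by the integral element \<open>- x\<close> preserves this.\<close>

lemma coeff_gt0_of_higher_pderiv_gt0:
  assumes "\<And>k. 0 < v (poly ((pderiv ^^ k) p) x)" "0 \<le> v x"
  shows "0 < v (coeff p k)"
proof -
  define q where "q = pcompose p [:x, 1:]"
  have "0 < v (coeff q k)" for k
    using assms(1)[of k] v_div_gt0_iff[of "fact k"] by (simp add: q_def coeff_pcompose_taylor v_fact)
  then have "0 < v (coeff (pcompose q [:- x, 1:]) k)"
    using assms(2) by (intro v_pcompose_shift_gt0) (auto simp: v_minus)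
  moreover have "pcompose q [:- x, 1:] = p"
    by (simp add: q_def pcompose_assoc[symmetric] pcompose_pCons)
  ultimately show ?thesis by simp
qed

text \<open>If the residue of \<open>f\<close>, rescaled so that \<open>a\<close> becomes \<open>0\<close> and \<open>y\<close> becomes \<open>1\<close>, vanishes at \<open>1\<close> with
  multiplicity \<open>m\<close>, then \<open>1\<close> is a simple zero of the residue of its derivative of order \<open>m - 1\<close>,
  so by Hensel's lemma that derivative has a root closer to \<open>y\<close> than \<open>a\<close>.\<close>

lemma taylor_dominant:
  fixes f :: "'a poly"
  assumes "f \<noteq> 0" "y \<noteq> a"
    and no_root: "\<And>k b. j \<le> k \<Longrightarrow> (pderiv ^^ k) f \<noteq> 0 \<Longrightarrow> poly ((pderiv ^^ k) f) b = 0 \<Longrightarrow>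
      \<not> v (y - a) < v (y - b)"
  defines "h \<equiv> pcompose f [:a, y - a:]"
  shows "\<exists>i\<le>j. \<forall>k. v (poly ((pderiv ^^ i) h) 1) \<le> v (coeff h k)"
proof -
  have "h \<noteq> 0" using assms pcompose_eq_0[of f "[:a, y - a:]"] by auto
  define V where "V = (\<lambda>k. v (coeff h k)) ` {..degree h}"
  have V: "finite V" "V \<noteq> {}" by (auto simp: V_def)
  from Min_in[OF V] obtain k0 where k0: "Min V = v (coeff h k0)" unfolding V_def by (rule imageE)
  \<comment> \<open>A coefficient of least value: dividing by it makes \<open>g\<close> integral
    with coefficient 1 at \<open>k0\<close>.\<close>
  define c where "c = coeff h k0"
  have c_le: "v c \<le> v (coeff h k)" for k
  proof (cases "k \<le> degree h")
    case True
    then have "v (coeff h k) \<in> V" by (auto simp: V_def)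
    then show ?thesis using Min_le[OF V(1)] k0 by (simp add: c_def)
  next
    case False
    then show ?thesis by (simp add: coeff_eq_0 v_0)
  qed
  have "c \<noteq> 0" using c_le[of "degree h"] \<open>h \<noteq> 0\<close> v_0_le_iff by auto
  define g where "g = smult (1 / c) h"
  have g: "0 \<le> v (coeff g k)" for k
    using c_le[of k] v_div_ge0_iff[OF \<open>c \<noteq> 0\<close>] by (simp add: g_def)
  have Dg: "0 \<le> v (coeff ((pderiv ^^ n) g) k)" for n k
    using g by (induction n arbitrary: k)
      (auto simp: coeff_pderiv simp del: of_nat_Suc intro: v_mult_ge0 v_of_nat_ge0)
  have h: "poly ((pderiv ^^ n) h) x = c * poly ((pderiv ^^ n) g) x" for n x
    using \<open>c \<noteq> 0\<close> by (simp add: g_def higher_pderiv_smult)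
  \<comment> \<open>Otherwise all coefficients of \<open>g\<close> would lie in the maximal ideal,
    including the one at \<open>k0\<close>. The least such index \<open>K\<close> is the
    multiplicity of 1 as a zero of the residue of \<open>g\<close>.\<close>
  have "\<exists>k. \<not> 0 < v (poly ((pderiv ^^ k) g) 1)"
    using coeff_gt0_of_higher_pderiv_gt0[of g 1 k0] v_1 \<open>c \<noteq> 0\<close> by (auto simp: g_def c_def)
  then obtain K where K: "\<not> 0 < v (poly ((pderiv ^^ K) g) 1)"
    and least: "\<And>k. k < K \<Longrightarrow> 0 < v (poly ((pderiv ^^ k) g) 1)"
    unfolding exists_least_iff[of "\<lambda>k. \<not> 0 < v (poly ((pderiv ^^ k) g) 1)"] by blast
  have K0: "v (poly ((pderiv ^^ K) g) 1) = 0"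
    using K v_poly_ge0[OF Dg, of 1 K] v_1 by (simp add: order.strict_iff_order)
  show ?thesis
  proof (cases "K \<le> j")
    case True
    have "v (poly ((pderiv ^^ K) h) 1) = v c" by (simp add: h v_mult K0)
    then show ?thesis using True c_le by auto
  next
    case False
    then obtain l where l: "K = Suc l" "j \<le> l" by (cases K) auto
    obtain b where b: "poly ((pderiv ^^ l) g) b = 0" "0 < v (b - 1)"
      using hensel[of "(pderiv ^^ l) g" 1] Dg least[of l] K0 l v_1 by auto
    have "poly ((pderiv ^^ l) f) (a + (y - a) * b) = 0"
      using h[of l b] b(1) assms(2) by (simp add: h_def poly_higher_pderiv_pcompose)
    moreover have "(pderiv ^^ l) f \<noteq> 0"
    proof
      assume "(pderiv ^^ l) f = 0"
      then have "(pderiv ^^ K) g = 0"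
        by (simp add: l g_def h_def higher_pderiv_smult higher_pderiv_pcompose_linear)
      then show False using K by (simp add: v_0 zero_extended_def)
    qed
    ultimately have "\<not> v (y - a) < v (y - (a + (y - a) * b))" using no_root l by blast
    \<comment> \<open>As \<open>b\<close> is congruent to 1, the root a + (y - a)b is strictly
      closer to \<open>y\<close> than \<open>a\<close> is.\<close>
    moreover have "v ((y - a) * 1) < v ((y - a) * (1 - b))"
      using b(2) assms(2) v_1 v_diff_commute[of 1 b] by (subst v_less_iff) auto
    ultimately show ?thesis by (simp add: algebra_simps)
  qed
qed

text \<open>With \<open>j = 0\<close>, \<open>taylor_dominant\<close> shows that no Taylor summand
  has smaller value than f(y). Hence \<open>rveq_sum\<close> applies to the expansions at
  \<open>a\<close> and \<open>a'\<close>.\<close>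

lemma rveq_poly_transfer:
  assumes rv: "\<And>k. rveq (poly ((pderiv ^^ k) f) a) (poly ((pderiv ^^ k) f') a')"
    and y: "rveq (y - a) (y' - a')"
    and no_root: "\<And>k b. (pderiv ^^ k) f \<noteq> 0 \<Longrightarrow> poly ((pderiv ^^ k) f) b = 0 \<Longrightarrow>
      \<not> v (y - a) < v (y - b)"
  shows "rveq (poly f y) (poly f' y')"
proof -
  define n where "n = max (degree f) (degree f')"
  let ?s = "\<lambda>k. (y - a) ^ k * poly ((pderiv ^^ k) f) a / fact k"
  let ?s' = "\<lambda>k. (y' - a') ^ k * poly ((pderiv ^^ k) f') a' / fact k"
  have f: "poly f y = sum ?s {..n}" and f': "poly f' y' = sum ?s' {..n}"
    by (intro poly_taylor; simp add: n_def)+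
  have "v (poly f y) \<le> v (?s k)" for k
  proof -
    consider "f = 0" | "y = a" "k = 0" | "y = a" "k \<noteq> 0" | "f \<noteq> 0" "y \<noteq> a" by blast
    then show ?thesis
    proof cases
      case 4
      then show ?thesis
        using taylor_dominant[of f y a 0] no_root
        by (auto simp: poly_pcompose coeff_pcompose_taylor)
    qed (auto simp: v_0 power_0_left)
  qed
  then show ?thesis unfolding f f'
    by (intro rveq_sum) (auto simp: divide_inverse intro!: rveq_mult rveq_power y rv)
qed

text \<open>Only roots of proper derivatives are kept away, since \<open>y\<close> is itself a root
  of \<open>f\<close>. With \<open>j = 1\<close>, \<open>taylor_dominant\<close> makes 1 a simple
  zero of the residue of the rescaled \<open>f\<close>; the rescaled \<open>f'\<close> has the same
  residue, so Hensel's lemma lifts that zero.\<close>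

lemma root_transfer:
  fixes f f' :: "'a poly"
  assumes rv: "\<And>k. rveq (poly ((pderiv ^^ k) f) a) (poly ((pderiv ^^ k) f') a')"
    and f: "f \<noteq> 0" "poly f y = 0"
    and no_root: "\<And>k b. 1 \<le> k \<Longrightarrow> (pderiv ^^ k) f \<noteq> 0 \<Longrightarrow> poly ((pderiv ^^ k) f) b = 0 \<Longrightarrow>
      \<not> v (y - a) < v (y - b)"
  obtains y' where "poly f' y' = 0" "rveq (y - a) (y' - a')"
proof (cases "y = a")
  case True
  then have "poly f' a' = 0" using rveq_zero[OF rv[of 0]] f(2) by simp
  then show thesis using True by (intro that[of a']) auto
next
  case False
  define t where "t = y - a"
  define h where "h = pcompose f [:a, t:]"
  \<comment> \<open>The centre moves to \<open>a'\<close>, but the scale \<open>t\<close> is kept,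
    so a root near 1 gives a difference to \<open>a'\<close> with the leading term of
    \<open>t\<close>.\<close>
  define h' where "h' = pcompose f' [:a', t:]"
  define c where "c = poly (pderiv h) 1"
  have "t \<noteq> 0" using False by (simp add: t_def)
  then have "h \<noteq> 0" using f(1) pcompose_eq_0[of f "[:a, t:]"] by (auto simp: h_def)
  have "poly h 1 = 0" using f(2) by (simp add: h_def t_def poly_pcompose)
  obtain i where i: "i \<le> 1" "\<And>k. v (poly ((pderiv ^^ i) h) 1) \<le> v (coeff h k)"
    using taylor_dominant[of f y a 1] f(1) False no_root unfolding h_def t_def by blast
  have "i \<noteq> 0"
  proof
    assume "i = 0"
    then have "v (lead_coeff h) = Pinf" using i(2)[of "degree h"] \<open>poly h 1 = 0\<close> v_0 by simp
    then show False using \<open>h \<noteq> 0\<close> v_Pinf by simp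
  qed
  then have "i = 1" using i(1) by simp
  then have c_le: "v c \<le> v (coeff h k)" for k using i(2) by (simp add: c_def)
  have "c \<noteq> 0" using c_le[of "degree h"] \<open>h \<noteq> 0\<close> v_0_le_iff by auto
  define g where "g = smult (1 / c) h"
  define g' where "g' = smult (1 / c) h'"
  have coeffs: "rveq (coeff h k) (coeff h' k)" for k
    by (simp add: h_def h'_def coeff_pcompose_taylor divide_inverse rveq_mult rv)
  have g: "0 \<le> v (coeff g k)" for k
    using c_le v_div_ge0_iff[OF \<open>c \<noteq> 0\<close>] by (simp add: g_def)
  have g': "0 \<le> v (coeff g' k)" for k
    using c_le v_div_ge0_iff[OF \<open>c \<noteq> 0\<close>] rveq_v[OF coeffs] by (simp add: g'_def)
  \<comment> \<open>Corresponding coefficients differ by something of value above their own, and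
    \<open>c\<close> has value at most that of any coefficient of \<open>h\<close>.\<close>
  have d: "0 < v (coeff (g' - g) k)" for k
  proof (cases "coeff h k = coeff h' k")
    case False
    then have "v c < v (coeff h' k - coeff h k)"
      using coeffs[of k] c_le[of k] v_diff_commute by (simp add: rveq_def)
    moreover have "coeff (g' - g) k = (coeff h' k - coeff h k) / c"
      by (simp add: g_def g'_def diff_divide_distrib)
    ultimately show ?thesis using v_div_gt0_iff[OF \<open>c \<noteq> 0\<close>] by simp
  qed (simp add: g_def g'_def v_0 zero_extended_def)
  have d': "0 < v (coeff (pderiv (g' - g)) k)" for k
    using v_mult_gt0[OF d v_of_nat_ge0] by (simp add: coeff_pderiv mult.commute del: of_nat_Suc)
  have "poly g 1 = 0" using \<open>poly h 1 = 0\<close> by (simp add: g_def)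
  then have "0 < v (poly g' 1)" using v_poly_gt0[OF d, of 1] v_1 by simp
  moreover have "poly (pderiv g) 1 = 1" using \<open>c \<noteq> 0\<close> by (simp add: g_def c_def pderiv_smult)
  then have "v (poly (pderiv g') 1) = 0"
    using v_poly_gt0[OF d', of 1] v_add_eq[of 1 "poly (pderiv g') 1 - 1"] v_1 by (simp add: pderiv_diff)
  ultimately obtain b where b: "poly g' b = 0" "0 < v (b - 1)" using hensel[OF g', of 1] v_1 by auto
  have "poly f' (a' + t * b) = 0"
    using b(1) \<open>c \<noteq> 0\<close> by (simp add: g'_def h'_def poly_pcompose mult.commute)
  moreover have "v (t * 1) < v (t * (1 - b))"
    using b(2) \<open>t \<noteq> 0\<close> v_1 v_diff_commute[of 1 b] by (subst v_less_iff) auto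
  then have "rveq (y - a) (a' + t * b - a')" by (simp add: rveq_def t_def algebra_simps)
  ultimately show thesis by (rule that)
qed

section \<open>Back-and-forth preserving leading terms\<close>

definition agree :: "((nat \<Rightarrow> 'a) \<Rightarrow> 'a) set \<Rightarrow> (nat \<Rightarrow> 'a) \<Rightarrow> (nat \<Rightarrow> 'a) \<Rightarrow> bool" where
  "agree F e e' \<longleftrightarrow> (\<forall>f\<in>F. rveq (f e) (f e'))"

lemma agreeD: "agree F e e' \<Longrightarrow> f \<in> F \<Longrightarrow> rveq (f e) (f e')"
  by (simp add: agree_def)

lemma agree_mono: "agree G e e' \<Longrightarrow> F \<subseteq> G \<Longrightarrow> agree F e e'"
  unfolding agree_def by blast

lemma agree_sym: "agree F e e' \<Longrightarrow> agree F e' e"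
  unfolding agree_def using rveq_sym by blast

text \<open>Roots of polynomials of degree at most \<open>d\<close> over the parameters can be answered in the
  Ehrenfeucht-Fraisse game in which the players preserve leading terms.\<close>

definition extendable :: "nat \<Rightarrow> bool" where
  "extendable d \<longleftrightarrow> (\<forall>F f. finite F \<longrightarrow> F \<subseteq> term_funs \<longrightarrow> f \<in> poly_funs d \<longrightarrow>
     (\<exists>G. finite G \<and> G \<subseteq> term_funs \<and>
       (\<forall>e e' y. agree G e e' \<longrightarrow> f e \<noteq> 0 \<longrightarrow> poly (f e) y = 0 \<longrightarrow>
         (\<exists>y'. agree F (case_nat y e) (case_nat y' e')))))"

lemma extendableD:
  assumes "extendable d" "finite F" "F \<subseteq> term_funs" "f \<in> poly_funs d"
  shows "\<exists>G. finite G \<and> G \<subseteq> term_funs \<and>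
       (\<forall>e e' y. agree G e e' \<longrightarrow> f e \<noteq> 0 \<longrightarrow> poly (f e) y = 0 \<longrightarrow>
         (\<exists>y'. agree F (case_nat y e) (case_nat y' e')))"
  using assms(1)[unfolded extendable_def, rule_format, OF assms(2-4)] .

text \<open>The point \<open>a\<close> is 0 or a root of some \<open>q e\<close>, so it can be
  answered by assumption; taking the candidate closest to \<open>y\<close> excludes closer
  roots.\<close>

lemma extendable_closest_root:
  assumes "extendable d" "finite Q" "Q \<subseteq> poly_funs d" "finite F" "F \<subseteq> term_funs"
  shows "\<exists>G. finite G \<and> G \<subseteq> term_funs \<and> (\<forall>e e' y. agree G e e' \<longrightarrow>
    (\<exists>a a'. agree F (case_nat a e) (case_nat a' e') \<and>
      (\<forall>q\<in>Q. \<forall>b. q e \<noteq> 0 \<longrightarrow> poly (q e) b = 0 \<longrightarrow> \<not> v (y - a) < v (y - b))))"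
proof -
  have "\<forall>q\<in>Q. \<exists>G. finite G \<and> G \<subseteq> term_funs \<and>
       (\<forall>e e' y. agree G e e' \<longrightarrow> q e \<noteq> 0 \<longrightarrow> poly (q e) y = 0 \<longrightarrow>
         (\<exists>y'. agree F (case_nat y e) (case_nat y' e')))"
    by (intro ballI extendableD[OF assms(1,4,5)] subsetD[OF assms(3)])
  from bchoice[OF this] obtain H where H: "\<forall>q\<in>Q. finite (H q) \<and> H q \<subseteq> term_funs \<and>
       (\<forall>e e' y. agree (H q) e e' \<longrightarrow> q e \<noteq> 0 \<longrightarrow> poly (q e) y = 0 \<longrightarrow>
         (\<exists>y'. agree F (case_nat y e) (case_nat y' e')))" by (rule exE)
  \<comment> \<open>The candidate 0 is answered by 0, which requires the functions in
    \<open>F\<close> to agree there.\<close>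
  define G0 where "G0 = (\<lambda>f e. f (case_nat 0 e)) ` F"
  define G where "G = G0 \<union> (\<Union>q\<in>Q. H q)"
  have case0: "(\<lambda>e. case_nat 0 e n) \<in> (term_funs :: ((nat \<Rightarrow> 'a) \<Rightarrow> 'a) set)" for n
    by (cases n) (simp_all add: term_funs_0 term_funs_var)
  have "G0 \<subseteq> term_funs"
    unfolding G0_def
  proof (rule image_subsetI)
    fix f assume "f \<in> F"
    then have "f \<in> term_funs" by (rule subsetD[OF assms(5)])
    from term_funs_subst[OF this case0] show "(\<lambda>e. f (case_nat 0 e)) \<in> term_funs" .
  qed
  moreover have HG: "finite (H q)" "H q \<subseteq> term_funs"
    "agree (H q) e e' \<Longrightarrow> q e \<noteq> 0 \<Longrightarrow> poly (q e) y = 0 \<Longrightarrow> \<exists>y'. agree F (case_nat y e) (case_nat y' e')"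
    if "q \<in> Q" for q e e' y
    using bspec[OF H that] by blast+
  ultimately have G: "finite G" "G \<subseteq> term_funs"
    using assms(2,4) unfolding G_def G0_def by blast+
  have "\<exists>a a'. agree F (case_nat a e) (case_nat a' e') \<and>
      (\<forall>q\<in>Q. \<forall>b. q e \<noteq> 0 \<longrightarrow> poly (q e) b = 0 \<longrightarrow> \<not> v (y - a) < v (y - b))"
    if ag: "agree G e e'" for e e' y
  proof -
    \<comment> \<open>Including 0 keeps the set nonempty even if there are no roots. The largest
      \<open>v (y - b)\<close> belongs to the closest point.\<close>
    define A where "A = insert 0 (\<Union>q\<in>{q \<in> Q. q e \<noteq> 0}. {b. poly (q e) b = 0})"
    have "finite A" unfolding A_def using assms(2) poly_roots_finite by auto
    then obtain a where a: "a \<in> A" and max: "\<And>b. b \<in> A \<Longrightarrow> v (y - b) \<le> v (y - a)"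
      using finite_ex_max[of A "\<lambda>b. v (y - b)"] by (auto simp: A_def)
    have "\<exists>a'. agree F (case_nat a e) (case_nat a' e')"
    proof (cases "a = 0")
      case True
      have "agree G0 e e'" using ag by (rule agree_mono) (simp add: G_def)
      then have "agree F (case_nat 0 e) (case_nat 0 e')" by (simp add: agree_def G0_def)
      then show ?thesis using True by blast
    next
      case False
      then obtain q where q: "q \<in> Q" "q e \<noteq> 0" "poly (q e) a = 0" using a by (auto simp: A_def)
      have "agree (H q) e e'" using ag by (rule agree_mono) (use q(1) in \<open>auto simp: G_def\<close>)
      from HG(3)[OF q(1) this q(2,3)] show ?thesis .
    qed
    moreover have "\<not> v (y - a) < v (y - b)" if "q \<in> Q" "q e \<noteq> 0" "poly (q e) b = 0" for q b
      using max[of b] that by (auto simp: A_def not_less)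
    ultimately show ?thesis by blast
  qed
  with G show ?thesis by (intro exI[of _ G] conjI allI impI)
qed

text \<open>Orders up to \<open>d\<close> suffice for formal degree at most \<open>d\<close>,
  because all further derivatives vanish.\<close>

definition higher_pderivs :: "nat \<Rightarrow> ((nat \<Rightarrow> 'a) \<Rightarrow> 'a poly) set \<Rightarrow> ((nat \<Rightarrow> 'a) \<Rightarrow> 'a poly) set" where
  "higher_pderivs d Q = (\<lambda>(q, k) e. (pderiv ^^ k) (q e)) ` (Q \<times> {..d})"

text \<open>The closest root is taken for the family closed under derivatives, and \<open>F\<close>
  is enlarged by the values of these derivatives at the new point. This supplies exactly the Taylor
  data that \<open>rveq_poly_transfer\<close> asks for.\<close>

lemma extendable_closest_root_taylor:
  assumes "extendable d" "finite Q" "Q \<subseteq> poly_funs d" "finite F" "F \<subseteq> term_funs"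
  shows "\<exists>G. finite G \<and> G \<subseteq> term_funs \<and> (\<forall>e e' y. agree G e e' \<longrightarrow>
    (\<exists>a a'. agree F (case_nat a e) (case_nat a' e') \<and>
      (\<forall>q\<in>Q. \<forall>k. rveq (poly ((pderiv ^^ k) (q e)) a) (poly ((pderiv ^^ k) (q e')) a') \<and>
        (\<forall>b. (pderiv ^^ k) (q e) \<noteq> 0 \<longrightarrow> poly ((pderiv ^^ k) (q e)) b = 0 \<longrightarrow>
          \<not> v (y - a) < v (y - b)))))"
proof -
  define Q' where "Q' = higher_pderivs d Q"
  have Q'I: "(\<lambda>e. (pderiv ^^ k) (q e)) \<in> Q'" if "q \<in> Q" "k \<le> d" for q k
    unfolding Q'_def higher_pderivs_def using that by (intro image_eqI[of _ _ "(q, k)"]) auto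
  have Q': "finite Q'" "Q' \<subseteq> poly_funs d"
    using assms(2,3) poly_funs_higher_pderiv by (auto simp: Q'_def higher_pderivs_def)
  have zero: "(pderiv ^^ k) (q e) = 0" if "q \<in> Q" "d < k" for q k e
  proof -
    have "degree (q e) < k" using poly_funs_degree[OF subsetD[OF assms(3) that(1)], of e] that(2) by simp
    then show ?thesis by (intro poly_eqI) (simp add: coeff_higher_pderiv coeff_eq_0)
  qed
  define F' where "F' = F \<union> (\<lambda>q e. poly (q (\<lambda>i. e (Suc i))) (e 0)) ` Q'"
  have "(\<lambda>e. poly (q (\<lambda>i. e (Suc i))) (e 0)) \<in> term_funs" if "q \<in> Q'" for q
    by (rule poly_funs_poly[OF subsetD[OF Q'(2) that]])
  then have F': "finite F'" "F' \<subseteq> term_funs" using assms(4,5) Q'(1) by (auto simp: F'_def)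
  from extendable_closest_root[OF assms(1) Q' F'] obtain G where G: "finite G" "G \<subseteq> term_funs"
    and ext: "\<forall>e e' y. agree G e e' \<longrightarrow> (\<exists>a a'. agree F' (case_nat a e) (case_nat a' e') \<and>
      (\<forall>q\<in>Q'. \<forall>b. q e \<noteq> 0 \<longrightarrow> poly (q e) b = 0 \<longrightarrow> \<not> v (y - a) < v (y - b)))"
    by (elim exE conjE)
  have "\<exists>a a'. agree F (case_nat a e) (case_nat a' e') \<and>
      (\<forall>q\<in>Q. \<forall>k. rveq (poly ((pderiv ^^ k) (q e)) a) (poly ((pderiv ^^ k) (q e')) a') \<and>
        (\<forall>b. (pderiv ^^ k) (q e) \<noteq> 0 \<longrightarrow> poly ((pderiv ^^ k) (q e)) b = 0 \<longrightarrow>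
          \<not> v (y - a) < v (y - b)))" if ag: "agree G e e'" for e e' y
  proof -
    obtain a a' where a: "agree F' (case_nat a e) (case_nat a' e')"
      and root: "\<forall>q\<in>Q'. \<forall>b. q e \<noteq> 0 \<longrightarrow> poly (q e) b = 0 \<longrightarrow> \<not> v (y - a) < v (y - b)"
      using ext ag by blast
    have "rveq (poly ((pderiv ^^ k) (q e)) a) (poly ((pderiv ^^ k) (q e')) a') \<and>
        (\<forall>b. (pderiv ^^ k) (q e) \<noteq> 0 \<longrightarrow> poly ((pderiv ^^ k) (q e)) b = 0 \<longrightarrow>
          \<not> v (y - a) < v (y - b))" if "q \<in> Q" for q k
    proof (cases "k \<le> d")
      case True
      have "(\<lambda>e. poly ((pderiv ^^ k) (q (\<lambda>i. e (Suc i)))) (e 0)) \<in> F'"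
        unfolding F'_def using Q'I[OF that True] by (intro UnI2 image_eqI[OF _ Q'I[OF that True]]) simp
      from agreeD[OF a this] show ?thesis using bspec[OF root Q'I[OF that True]] by simp
    next
      case False
      then show ?thesis using zero[OF that] by simp
    qed
    moreover have "agree F (case_nat a e) (case_nat a' e')"
      using a by (rule agree_mono) (simp add: F'_def)
    ultimately show ?thesis by blast
  qed
  with G show ?thesis by blast
qed

text \<open>Induction on the degree. At a root of \<open>f\<close>, every function in
  \<open>F\<close> can be replaced by its pseudo-remainder modulo \<open>f\<close>, which has
  smaller formal degree. The induction hypothesis gives a centre for the remainders and the
  derivative of \<open>f\<close>; \<open>root_transfer\<close> then finds the answer and
  \<open>rveq_poly_transfer\<close> controls the remainders there.\<close>

lemma extendable: "extendable d"
proof (induction d)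
  case 0
  have "poly (f e) y \<noteq> 0" if "f \<in> poly_funs 0" "f e \<noteq> 0" for f e and y :: 'a
    using poly_funs_degree[OF that(1), of e] that(2) by (auto elim: degree_eq_zeroE)
  then show ?case unfolding extendable_def by (metis empty_subsetI finite.emptyI)
next
  case (Suc d)
  show ?case unfolding extendable_def
  proof (intro allI impI)
    fix F :: "((nat \<Rightarrow> 'a) \<Rightarrow> 'a) set" and f :: "(nat \<Rightarrow> 'a) \<Rightarrow> 'a poly"
    assume F: "finite F" "F \<subseteq> term_funs" and f: "f \<in> poly_funs (Suc d)"
    let ?lc = "\<lambda>e. coeff (f e) (Suc d)"
    obtain P n where P: "\<And>t. t \<in> F \<Longrightarrow> P t \<in> poly_funs n"
      and tP: "\<And>t y e. t \<in> F \<Longrightarrow> t (case_nat y e) = poly (P t e) y"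
      by (rule term_funs_as_polys[OF F]) (rule that)
    have "\<forall>t\<in>F. \<exists>N r. r \<in> poly_funs d \<and> (\<forall>e. \<exists>q. smult (?lc e ^ N) (P t e) = q * f e + r e)"
      using poly_funs_pseudo_mod[OF f P] unfolding Bex_def by (intro ballI)
    from bchoice[OF this] obtain N where
      "\<forall>t\<in>F. \<exists>r. r \<in> poly_funs d \<and> (\<forall>e. \<exists>q. smult (?lc e ^ N t) (P t e) = q * f e + r e)" by (rule exE)
    from bchoice[OF this] obtain R where
      R: "\<forall>t\<in>F. R t \<in> poly_funs d \<and> (\<forall>e. \<exists>q. smult (?lc e ^ N t) (P t e) = q * f e + R t e)" by (rule exE)
    \<comment> \<open>The polynomial \<open>f\<close> has too large a degree for the induction
      hypothesis, so its derivative is included instead. The value of \<open>f\<close> at the centre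
      is tracked separately by \<open>?fa\<close>.\<close>
    define Q where "Q = insert (\<lambda>e. pderiv (f e)) (R ` F)"
    have Q: "finite Q" "Q \<subseteq> poly_funs d"
      using F(1) R poly_funs_pderiv[OF f] by (auto simp: Q_def)
    let ?fa = "\<lambda>e. poly (f (\<lambda>i. e (Suc i))) (e 0)"
    have fa: "finite {?fa}" "{?fa} \<subseteq> term_funs" using poly_funs_poly[OF f] by simp_all
    from extendable_closest_root_taylor[OF Suc Q fa] obtain G1 where G1: "finite G1" "G1 \<subseteq> term_funs"
      and ext1: "\<forall>e e' y. agree G1 e e' \<longrightarrow> (\<exists>a a'. agree {?fa} (case_nat a e) (case_nat a' e') \<and>
        (\<forall>q\<in>Q. \<forall>k. rveq (poly ((pderiv ^^ k) (q e)) a) (poly ((pderiv ^^ k) (q e')) a') \<and>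
          (\<forall>b. (pderiv ^^ k) (q e) \<noteq> 0 \<longrightarrow> poly ((pderiv ^^ k) (q e)) b = 0 \<longrightarrow>
            \<not> v (y - a) < v (y - b))))"
      by (elim exE conjE)
    \<comment> \<open>Covers the environments where the formal leading coefficient vanishes: there
      it equals \<open>f\<close>, while its formal degree is \<open>d\<close> everywhere.\<close>
    let ?tr = "\<lambda>e. f e - monom (?lc e) (Suc d)"
    have "(\<lambda>e. coeff (f e) k - coeff (monom (?lc e) (Suc d)) k) \<in> term_funs" for k
      by (cases "k = Suc d") (simp_all add: term_funs_0 poly_funs_coeff[OF f])
    then have "?tr \<in> poly_funs d"
      by (intro poly_funsI) (auto simp: poly_funs_coeff_eq_0[OF f])
    from extendableD[OF Suc F this] obtain G2 where G2: "finite G2" "G2 \<subseteq> term_funs"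
      and ext2: "\<forall>e e' y. agree G2 e e' \<longrightarrow> ?tr e \<noteq> 0 \<longrightarrow> poly (?tr e) y = 0 \<longrightarrow>
         (\<exists>y'. agree F (case_nat y e) (case_nat y' e'))"
      by (elim exE conjE)
    define G where "G = insert ?lc (G1 \<union> G2)"
    have G: "finite G" "G \<subseteq> term_funs"
      using G1 G2 poly_funs_coeff[OF f] by (simp_all add: G_def)
    have "\<exists>y'. agree F (case_nat y e) (case_nat y' e')"
      if ag: "agree G e e'" and fe: "f e \<noteq> 0" "poly (f e) y = 0" for e e' y
    proof (cases "?lc e = 0")
      case True
      then have "?tr e = f e" by simp
      moreover have "agree G2 e e'" using ag by (rule agree_mono) (auto simp: G_def)
      ultimately show ?thesis using ext2 fe by metis
    next
      case False
      have lc: "rveq (?lc e) (?lc e')" using ag by (rule agreeD) (simp add: G_def)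
      have "agree G1 e e'" using ag by (rule agree_mono) (auto simp: G_def)
      then obtain a a' where a: "agree {?fa} (case_nat a e) (case_nat a' e')"
        and tay: "\<forall>q\<in>Q. \<forall>k. rveq (poly ((pderiv ^^ k) (q e)) a) (poly ((pderiv ^^ k) (q e')) a') \<and>
          (\<forall>b. (pderiv ^^ k) (q e) \<noteq> 0 \<longrightarrow> poly ((pderiv ^^ k) (q e)) b = 0 \<longrightarrow>
            \<not> v (y - a) < v (y - b))"
        using ext1 by blast
      have f0: "rveq (poly (f e) a) (poly (f e') a')" using a by (simp add: agree_def)
      have "(\<lambda>e. pderiv (f e)) \<in> Q" by (simp add: Q_def)
      note fk = bspec[OF tay this, rule_format]
      \<comment> \<open>For \<open>k > 0\<close>, the derivative of order \<open>k\<close> of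
        \<open>f\<close> is that of order \<open>k - 1\<close> of \<open>pderiv f\<close>; order 0
        is \<open>f0\<close>.\<close>
      have fk1: "rveq (poly ((pderiv ^^ k) (f e)) a) (poly ((pderiv ^^ k) (f e')) a')" for k
        using f0 fk[of "k - 1"] by (cases k) (simp_all add: funpow_Suc_right del: funpow.simps(2))
      have fk2: "\<not> v (y - a) < v (y - b)"
        if "1 \<le> k" "(pderiv ^^ k) (f e) \<noteq> 0" "poly ((pderiv ^^ k) (f e)) b = 0" for k b
        using that fk[of "k - 1"] by (cases k) (simp_all add: funpow_Suc_right del: funpow.simps(2))
      obtain y' where y': "poly (f e') y' = 0" "rveq (y - a) (y' - a')"
        using root_transfer[OF fk1 fe fk2] .
      have "rveq (t (case_nat y e)) (t (case_nat y' e'))" if t: "t \<in> F" for t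
      proof -
        have "R t \<in> Q" using t by (simp add: Q_def)
        note Rk = bspec[OF tay this, rule_format]
        have "rveq (poly (R t e) y) (poly (R t e') y')"
          by (rule rveq_poly_transfer[OF _ y'(2)]) (use Rk in blast)+
        \<comment> \<open>At a root of \<open>f\<close> the multiple of \<open>f\<close> in the
          pseudo-division disappears.\<close>
        moreover have *: "?lc e ^ N t * poly (P t e) y = poly (R t e) y" if "poly (f e) y = 0" for e y
        proof -
          obtain q where "smult (?lc e ^ N t) (P t e) = q * f e + R t e"
            using bspec[OF R t] by blast
          from arg_cong[OF this, of "\<lambda>p. poly p y"] show ?thesis using that by simp
        qed
        ultimately have "rveq (?lc e ^ N t * poly (P t e) y) (?lc e' ^ N t * poly (P t e') y')"
          using fe(2) y'(1) by simp
        from rveq_mult_cancel[OF rveq_power[OF lc] _ this] False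
        show ?thesis by (simp add: tP[OF t])
      qed
      then show ?thesis unfolding agree_def by blast
    qed
    with G show "\<exists>G. finite G \<and> G \<subseteq> term_funs \<and>
       (\<forall>e e' y. agree G e e' \<longrightarrow> f e \<noteq> 0 \<longrightarrow> poly (f e) y = 0 \<longrightarrow>
         (\<exists>y'. agree F (case_nat y e) (case_nat y' e')))" by blast
  qed
qed

text \<open>An arbitrary \<open>y\<close> need not satisfy an equation, so its answer can be the
  translate a' + (y - a), where \<open>a\<close> is a closest root of all polynomials involved and
  their derivatives.\<close>

lemma agree_extend:
  assumes F: "finite F" "F \<subseteq> term_funs"
  shows "\<exists>G. finite G \<and> G \<subseteq> term_funs \<and>
    (\<forall>e e' y. agree G e e' \<longrightarrow> (\<exists>y'. agree F (case_nat y e) (case_nat y' e')))"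
proof -
  obtain P n where P: "\<And>t. t \<in> F \<Longrightarrow> P t \<in> poly_funs n"
    and tP: "\<And>t y e. t \<in> F \<Longrightarrow> t (case_nat y e) = poly (P t e) y"
    by (rule term_funs_as_polys[OF F]) (rule that)
  have Q: "finite (P ` F)" "P ` F \<subseteq> poly_funs n" using F(1) P by auto
  from extendable_closest_root_taylor[OF extendable Q, of "{}"]
  obtain G where G: "finite G" "G \<subseteq> term_funs"
    and ext: "\<forall>e e' y. agree G e e' \<longrightarrow> (\<exists>a a'. agree {} (case_nat a e) (case_nat a' e') \<and>
      (\<forall>q\<in>P ` F. \<forall>k. rveq (poly ((pderiv ^^ k) (q e)) a) (poly ((pderiv ^^ k) (q e')) a') \<and>
        (\<forall>b. (pderiv ^^ k) (q e) \<noteq> 0 \<longrightarrow> poly ((pderiv ^^ k) (q e)) b = 0 \<longrightarrow>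
          \<not> v (y - a) < v (y - b))))"
    by blast
  have "\<exists>y'. agree F (case_nat y e) (case_nat y' e')" if ag: "agree G e e'" for e e' y
  proof -
    obtain a a' where a: "\<forall>q\<in>P ` F. \<forall>k. rveq (poly ((pderiv ^^ k) (q e)) a) (poly ((pderiv ^^ k) (q e')) a') \<and>
        (\<forall>b. (pderiv ^^ k) (q e) \<noteq> 0 \<longrightarrow> poly ((pderiv ^^ k) (q e)) b = 0 \<longrightarrow>
          \<not> v (y - a) < v (y - b))"
      using ext ag by blast
    have y: "rveq (y - a) ((a' + (y - a)) - a')" by simp
    have "rveq (t (case_nat y e)) (t (case_nat (a' + (y - a)) e'))" if t: "t \<in> F" for t
    proof -
      have "P t \<in> P ` F" using t by simp
      note Pk = bspec[OF a this, rule_format]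
      have "rveq (poly (P t e) y) (poly (P t e') (a' + (y - a)))"
        by (rule rveq_poly_transfer[OF _ y]) (use Pk in blast)+
      then show ?thesis by (simp add: tP[OF t])
    qed
    then show ?thesis unfolding agree_def by blast
  qed
  with G show ?thesis by blast
qed

section \<open>Formulas depend on leading terms only, and definable sets are locally
  constant\<close>

text \<open>Atomic formulas compare a difference of terms with 0, and both its vanishing and its
  sign are visible in the leading term. A quantifier costs one application of
  \<open>agree_extend\<close>.\<close>

lemma or_sat_agree:
  "\<exists>F. finite F \<and> F \<subseteq> term_funs \<and> (\<forall>e e' :: nat \<Rightarrow> 'a. agree F e e' \<longrightarrow> or_sat e p = or_sat e' p)"
proof (induction p)
  case (Eq s t)
  let ?f = "\<lambda>e :: nat \<Rightarrow> 'a. or_eval e s - or_eval e t"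
  have "?f \<in> term_funs" by (rule term_funs_diff; rule term_funsI; rule refl)
  moreover have "or_sat e (Eq s t) = or_sat e' (Eq s t)" if "agree {?f} e e'" for e e'
    using rveq_zero[OF agreeD[OF that singletonI]] by simp
  ultimately show ?case by (intro exI[of _ "{?f}"]) simp
next
  case (Less s t)
  let ?f = "\<lambda>e :: nat \<Rightarrow> 'a. or_eval e t - or_eval e s"
  have "?f \<in> term_funs" by (rule term_funs_diff; rule term_funsI; rule refl)
  moreover have "or_sat e (Less s t) = or_sat e' (Less s t)" if "agree {?f} e e'" for e e'
    using rveq_pos[OF agreeD[OF that singletonI]] rveq_pos[OF agreeD[OF agree_sym[OF that] singletonI]]
    by auto
  ultimately show ?case by (intro exI[of _ "{?f}"]) simp
next
  case (Negation p)
  then show ?case by simp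
next
  case (Conj p q)
  then obtain F G where F: "finite F" "F \<subseteq> term_funs"
      "\<forall>e e' :: nat \<Rightarrow> 'a. agree F e e' \<longrightarrow> or_sat e p = or_sat e' p"
    and G: "finite G" "G \<subseteq> term_funs"
      "\<forall>e e' :: nat \<Rightarrow> 'a. agree G e e' \<longrightarrow> or_sat e q = or_sat e' q"
    by (elim exE conjE)
  have "or_sat e (Conj p q) = or_sat e' (Conj p q)" if "agree (F \<union> G) e e'" for e e'
    using F(3) G(3) agree_mono[OF that, of F] agree_mono[OF that, of G] by simp
  then show ?case using F(1,2) G(1,2) by (intro exI[of _ "F \<union> G"]) simp
next
  case (Exists p)
  then obtain F where F: "finite F" "F \<subseteq> term_funs"
      "\<forall>e e' :: nat \<Rightarrow> 'a. agree F e e' \<longrightarrow> or_sat e p = or_sat e' p"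
    by (elim exE conjE)
  from agree_extend[OF F(1,2)] obtain G where G: "finite G" "G \<subseteq> term_funs"
    and ext: "\<forall>e e' y. agree G e e' \<longrightarrow> (\<exists>y'. agree F (case_nat y e) (case_nat y' e'))"
    by (elim exE conjE)
  \<comment> \<open>One direction is enough, because \<open>agree\<close> is symmetric.\<close>
  have "or_sat e' (Exists p)" if ag: "agree G e e'" and ex: "or_sat e (Exists p)" for e e'
  proof -
    from ex obtain x where x: "or_sat (case_nat x e) p" by auto
    from ext ag obtain x' where "agree F (case_nat x e) (case_nat x' e')" by blast
    with F(3) x have "or_sat (case_nat x' e') p" by blast
    then show ?thesis by auto
  qed
  then have "or_sat e (Exists p) = or_sat e' (Exists p)" if "agree G e e'" for e e'
    using that agree_sym by blast
  then show ?case using G by blast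
qed

text \<open>The parameters \<open>c\<close> are the same on both sides, so the Taylor coefficients
  at the point of \<open>A\<close> closest to \<open>x\<close> are equal. The distance condition
  gives x - a and x' - a the same leading term, and \<open>rveq_poly_transfer\<close>
  applies.\<close>

lemma or_sat_locally_constant:
  obtains A :: "'a set" where "finite A"
    "\<And>x x'. (\<And>a. a \<in> A \<Longrightarrow> v (x - a) < v (x' - x)) \<Longrightarrow>
      or_sat (case_nat x c) p = or_sat (case_nat x' c) p"
proof -
  obtain F where F: "finite F" "F \<subseteq> term_funs"
    and sat: "\<forall>e e' :: nat \<Rightarrow> 'a. agree F e e' \<longrightarrow> or_sat e p = or_sat e' p"
    using or_sat_agree[of p] by (elim exE conjE)
  obtain P n where P: "\<And>t. t \<in> F \<Longrightarrow> P t \<in> poly_funs n"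
    and tP: "\<And>t y e. t \<in> F \<Longrightarrow> t (case_nat y e) = poly (P t e) y"
    by (rule term_funs_as_polys[OF F]) (rule that)
  define D where "D = (\<lambda>(t, k). (pderiv ^^ k) (P t c)) ` (F \<times> {..n})"
  define A where "A = insert 0 (\<Union>q\<in>D - {0}. {b. poly q b = 0})"
  have "finite A" using F(1) poly_roots_finite by (auto simp: A_def D_def)
  have in_A: "b \<in> A"
    if "t \<in> F" "(pderiv ^^ k) (P t c) \<noteq> 0" "poly ((pderiv ^^ k) (P t c)) b = 0" for t k b
  proof -
    have "k \<le> n"
    proof (rule ccontr)
      assume "\<not> k \<le> n"
      then have "degree (P t c) < k" using poly_funs_degree[OF P[OF that(1)], of c] by simp
      then have "(pderiv ^^ k) (P t c) = 0"
        by (intro poly_eqI) (simp add: coeff_higher_pderiv coeff_eq_0)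
      with that(2) show False ..
    qed
    then have "(pderiv ^^ k) (P t c) \<in> D"
      unfolding D_def using that(1) by (intro image_eqI[of _ _ "(t, k)"]) auto
    then show ?thesis using that by (auto simp: A_def)
  qed
  have "or_sat (case_nat x c) p = or_sat (case_nat x' c) p"
    if far: "\<And>a. a \<in> A \<Longrightarrow> v (x - a) < v (x' - x)" for x x'
  proof -
    obtain a where a: "a \<in> A" "\<And>b. b \<in> A \<Longrightarrow> v (x - b) \<le> v (x - a)"
      using finite_ex_max[of A "\<lambda>b. v (x - b)"] \<open>finite A\<close> by (auto simp: A_def)
    have "v (x - a) < v ((x - a) - (x' - a))"
      using far[OF a(1)] v_diff_commute[of x x'] by simp
    then have x: "rveq (x - a) (x' - a)" by (simp add: rveq_def)
    have "rveq (t (case_nat x c)) (t (case_nat x' c))" if t: "t \<in> F" for t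
    proof -
      have "rveq (poly (P t c) x) (poly (P t c) x')"
        by (rule rveq_poly_transfer[OF _ x]) (use a(2) in_A[OF t] in \<open>auto simp: not_less\<close>)
      then show ?thesis by (simp add: tP[OF t])
    qed
    then have "agree F (case_nat x c) (case_nat x' c)" unfolding agree_def by blast
    then show ?thesis using sat by blast
  qed
  with \<open>finite A\<close> show thesis by (rule that)
qed

end

section \<open>Incomparability contradicts local constancy\<close>

theorem proposition4p5:
  fixes v :: "'a::linordered_field \<Rightarrow> 'g::linordered_ab_group_add extended"
    and w :: "'a \<Rightarrow> 'h::linordered_ab_group_add extended"
  assumes "henselian v"
    and "is_valuation w"
    and "or_definable (valuation_ring w)"
  shows "comparable v w"
proof (rule ccontr)
  interpret v: henselian_ordered v
    using assms(1) by unfold_locales (simp_all add: henselian_def)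
  interpret w: valued w by unfold_locales (fact assms(2))
  assume "\<not> comparable v w"
  then have "\<exists>\<alpha>. 0 \<le> v \<alpha> \<and> w \<alpha> < 0" "\<exists>\<beta>. 0 \<le> w \<beta> \<and> v \<beta> < 0"
    unfolding comparable_def valuation_ring_def by (auto simp: subset_iff not_le)
  then obtain \<alpha> \<beta> where \<alpha>: "0 \<le> v \<alpha>" "w \<alpha> < 0" and \<beta>: "0 \<le> w \<beta>" "v \<beta> < 0" by blast
  have nz: "\<alpha> \<noteq> 0" "\<beta> \<noteq> 0" using \<alpha>(2) \<beta>(2) v.v_0 w.v_0 by auto
  define \<gamma> where "\<gamma> = \<alpha> / \<beta>"
  define \<theta> where "\<theta> = \<beta> / \<alpha>"
  have v\<gamma>: "0 < v \<gamma>" using \<alpha>(1) \<beta>(2) v.v_div_gt0_iff[OF nz(2)] by (simp add: \<gamma>_def)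
  have w\<gamma>: "w \<gamma> < 0"
    using \<alpha>(2) \<beta>(1) w.v_div_ge0_iff[OF nz(2), of \<alpha>] by (simp add: \<gamma>_def not_le[symmetric])
  have v\<theta>: "v \<theta> < 0"
    using \<alpha>(1) \<beta>(2) v.v_div_ge0_iff[OF nz(1), of \<beta>] by (simp add: \<theta>_def not_le[symmetric])
  have w\<theta>: "0 \<le> w \<theta>" using \<alpha>(2) \<beta>(1) w.v_div_gt0_iff[OF nz(1)] by (simp add: \<theta>_def less_imp_le)
  have w\<theta>_power: "0 \<le> w (\<theta> ^ n)" for n
    by (induction n) (auto simp: w.v_1 intro: w.v_mult_ge0 w\<theta>)
  have "\<theta> \<noteq> 0" using nz by (simp add: \<theta>_def)
  have v\<theta>_Suc: "v (\<theta> ^ Suc n) < v (\<theta> ^ n)" for n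
    using v.v_less_iff[of "\<theta> ^ n" \<theta> 1] v\<theta> v.v_1 \<open>\<theta> \<noteq> 0\<close> by (simp add: mult.commute)
  have v\<theta>_less: "v (\<theta> ^ j) < v (\<theta> ^ i)" if "i < j" for i j
    using that by (induction j) (auto simp: less_Suc_eq simp del: power_Suc intro: v\<theta>_Suc less_trans)
  have v\<theta>_diff: "v (\<theta> ^ i - \<theta> ^ j) < 0" if "i < j" for i j
  proof -
    have "v (\<theta> ^ j - \<theta> ^ i) = v (\<theta> ^ j)"
      using v.v_add_eq[of "\<theta> ^ j" "- (\<theta> ^ i)"] v\<theta>_less[OF that] by (simp add: v.v_minus)
    also have "\<dots> < 0" using v\<theta>_less[of 0 j] that by (simp add: v.v_1)
    finally show ?thesis by (simp add: v.v_diff_commute)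
  qed
  obtain p c where def_w: "valuation_ring w = {x. or_sat (case_nat x c) p}"
    using assms(3) unfolding or_definable_def by blast
  obtain A where A: "finite A" and const: "\<And>x x'. (\<And>a. a \<in> A \<Longrightarrow> v (x - a) < v (x' - x)) \<Longrightarrow>
      or_sat (case_nat x c) p = or_sat (case_nat x' c) p"
    using v.or_sat_locally_constant[of c p] by blast
  \<comment> \<open>Pigeonhole: otherwise two different powers would be at nonnegative distance from
    the same point of the finite set \<open>A\<close>, hence from each other.\<close>
  have "\<exists>n. \<forall>a\<in>A. v (\<theta> ^ n - a) < 0"
  proof (rule ccontr)
    assume "\<not> ?thesis"
    then have "\<forall>n. \<exists>a. a \<in> A \<and> 0 \<le> v (\<theta> ^ n - a)" by (auto simp: not_less)
    then obtain h where h: "\<And>n. h n \<in> A" "\<And>n. 0 \<le> v (\<theta> ^ n - h n)" by metis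
    then have "\<not> inj h" using A by (metis finite_imageD finite_subset image_subsetI infinite_UNIV_nat)
    then obtain i j where ij: "h i = h j" "i < j" unfolding inj_def by (metis linorder_neqE_nat)
    have "0 \<le> v ((\<theta> ^ i - h i) + (h j - \<theta> ^ j))"
      using h(2)[of i] h(2)[of j] by (intro v.v_add_ge) (auto simp: v.v_diff_commute)
    then show False using v\<theta>_diff[OF ij(2)] ij(1) by (simp add: not_le[symmetric])
  qed
  then obtain n where n: "\<And>a. a \<in> A \<Longrightarrow> v (\<theta> ^ n - a) < 0" by blast
  have "v (\<theta> ^ n - a) < v (\<theta> ^ n + \<gamma> - \<theta> ^ n)" if "a \<in> A" for a
    using n[OF that] v\<gamma> by simp
  from const[OF this] have "\<theta> ^ n \<in> valuation_ring w \<longleftrightarrow> \<theta> ^ n + \<gamma> \<in> valuation_ring w"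
    by (simp add: def_w)
  \<comment> \<open>The summand \<gamma> has negative value and the power of \<theta> does not, so
    the sum leaves the valuation ring of \<open>w\<close>.\<close>
  moreover have "w (\<gamma> + \<theta> ^ n) = w \<gamma>" using w\<gamma> w\<theta>_power[of n] by (intro w.v_add_eq) simp
  ultimately show False
    using w\<gamma> w\<theta>_power[of n] by (simp add: valuation_ring_def add.commute)
qed

end
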